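(* There exists a sequence of polynomials $\mathcal P_n$, $n=1,2,\dots$, with $\mathcal P_n$ of degree $n$, $\mathcal P_1=x$ and $\mathcal P_2=x^2-2x+2$, such that for every $n\ge1$ $$\mathcal P_{n+1}''\mathcal P_n-2\mathcal P_{n+1}'\mathcal P_n'+\mathcal P_{n+1}\mathcal P_n''+n\,\mathcal P_{n+1}'\mathcal P_n-(n+1)\mathcal P_{n+1}\mathcal P_n'=0 .$$ Moreover, up to the constant factor $c_n=\big[(n-1)!\prod_{1\le i<j\le n-1}(j-i)\big]^{-1}$, these polynomials can be written as $$\mathcal P_n=c_n\exp\Big(-\frac{n(n-1)x}{2}\Big)W(\omega_1,\dots,\omega_n),$$ where $W$ denotes the Wronskian, $\omega_j=(x-a_j)\exp((j-1)x)$, and $a_1=0$, $a_{j+1}=a_j+\frac2j$. *)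

theory Defs
  imports "HOL-Analysis.Analysis" "HOL-Computational_Algebra.Polynomial" "Jordan_Normal_Form.Determinant"
begin

definition wronskian :: "nat \<Rightarrow> (nat \<Rightarrow> real \<Rightarrow> real) \<Rightarrow> real \<Rightarrow> real" where
  "wronskian n f x = det (mat n n (\<lambda>(i, j). (deriv ^^ i) (f (j + 1)) x))"

(* a_1 = 0, a_{j+1} = a_j + 2/j  (a_coef 0 is an unused junk value) *)
fun a_coef :: "nat \<Rightarrow> real" where
  "a_coef 0 = 0"
| "a_coef (Suc 0) = 0"
| "a_coef (Suc (Suc j)) = a_coef (Suc j) + 2 / real (Suc j)"

definition omega :: "nat \<Rightarrow> real \<Rightarrow> real" where
  "omega j x = (x - a_coef j) * exp (real (j - 1) * x)"

definition c_const :: "nat \<Rightarrow> real" where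
  "c_const n = 1 / (fact (n - 1) * (\<Prod>j\<in>{1..n-1}. \<Prod>i\<in>{1..<j}. real (j - i)))"

end

theory Submission
  imports Defs "HOL-Computational_Algebra.Formal_Laurent_Series"
begin

text \<open>
  Write \<open>D\<close> for the derivative. The operator \<open>h\<^sub>0 = e\<^sup>-\<^sup>x D\<^sup>2\<close> satisfies \<open>h\<^sub>0 \<omega>\<^sub>1 = 0\<close> and
  \<open>h\<^sub>0 \<omega>\<^sub>j\<^sub>+\<^sub>1 = j\<^sup>2 \<omega>\<^sub>j\<close>; this is exactly what the choice \<open>a\<^sub>j\<^sub>+\<^sub>1 = a\<^sub>j + 2/j\<close> achieves. Hence the
  span of \<open>\<omega>\<^sub>1, \<dots>, \<omega>\<^sub>n\<close> is \<open>h\<^sub>0\<close>-invariant, and the monic operator \<open>L\<^sub>n\<close> of order \<open>n\<close> with this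
  kernel intertwines \<open>h\<^sub>0\<close> with an operator \<open>h\<^sub>n\<close>. Factoring \<open>L\<^sub>n\<close> into first-order operators
  (Darboux transformations) gives \<open>h\<^sub>n = e\<^sup>-\<^sup>x (D\<^sup>2 - n D + 2 (log P\<^sub>n)'' - (log P\<^sub>n)')\<close>. The function
  \<open>\<psi> = L\<^sub>n \<omega>\<^sub>n\<^sub>+\<^sub>1 = W\<^sub>n\<^sub>+\<^sub>1 / W\<^sub>n\<close>, a constant multiple of \<open>e\<^sup>n\<^sup>x P\<^sub>n\<^sub>+\<^sub>1 / P\<^sub>n\<close>, satisfies
  \<open>h\<^sub>n \<psi> = L\<^sub>n h\<^sub>0 \<omega>\<^sub>n\<^sub>+\<^sub>1 = n\<^sup>2 L\<^sub>n \<omega>\<^sub>n = 0\<close>, and this is the bilinear equation. The divisions are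
  carried out in the field of formal Laurent series, so that zeros of the Wronskians do no harm.
\<close>

hide_const (open) module.smult

subsection \<open>Determinants\<close>

lemma det_scale_columns:
  fixes q :: "nat \<Rightarrow> nat \<Rightarrow> 'a :: comm_ring_1"
  shows "det (mat n n (\<lambda>(i, j). q i j * c j)) = det (mat n n (\<lambda>(i, j). q i j)) * (\<Prod>j<n. c j)"
proof -
  have "mat n n (\<lambda>(i, j). q i j * c j) = mat n n (\<lambda>(i, j). q i j) * mat_diag n c"
    by (subst mat_diag_mult_right[of _ n n]) auto
  moreover have "det (mat_diag n c) = (\<Prod>j<n. c j)"
    by (subst det_lower_triangular[of n])
       (auto simp: mat_diag_def prod_list_diag_prod atLeast0LessThan intro!: prod.cong)
  ultimately show ?thesis
    by (simp add: det_mult[of _ n])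
qed

lemma (in comm_ring_hom) det_hom_scale_columns:
  "det (mat n n (\<lambda>(i, j). hom (q i j) * c j)) = hom (det (mat n n (\<lambda>(i, j). q i j))) * (\<Prod>j<n. c j)"
proof -
  have "mat n n (\<lambda>(i, j). hom (q i j)) = map_mat hom (mat n n (\<lambda>(i, j). q i j))"
    by (rule eq_matI) auto
  then show ?thesis
    by (simp add: det_scale_columns)
qed

lemma det_add_previous_rows:
  fixes q :: "nat \<Rightarrow> nat \<Rightarrow> 'a :: comm_ring_1"
  shows "det (mat n n (\<lambda>(i, j). q i j + (\<Sum>k<i. t i k * q k j))) = det (mat n n (\<lambda>(i, j). q i j))"
proof -
  define T where "T = mat n n (\<lambda>(i, k). if k < i then t i k else if k = i then 1 else 0)"
  have "T * mat n n (\<lambda>(i, j). q i j) = mat n n (\<lambda>(i, j). q i j + (\<Sum>k<i. t i k * q k j))"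
  proof (rule eq_matI; clarsimp simp: T_def scalar_prod_def atLeast0LessThan)
    fix i j assume "i < n"
    have "(\<Sum>k<n. (if k < i then t i k else if k = i then 1 else 0) * q k j) =
        (\<Sum>k\<in>insert i {..<i}. (if k < i then t i k else if k = i then 1 else 0) * q k j)"
      using \<open>i < n\<close> by (intro sum.mono_neutral_right) auto
    then show "(\<Sum>k<n. (if k < i then t i k else if k = i then 1 else 0) * q k j) =
        q i j + (\<Sum>k<i. t i k * q k j)"
      by simp
  qed
  moreover have "det T = 1"
    by (subst det_lower_triangular[of n]) (auto simp: T_def prod_list_diag_prod)
  ultimately show ?thesis
    using det_mult[of T n "mat n n (\<lambda>(i, j). q i j)"] by (simp add: T_def)
qed

lemma det_first_column_zero:
  fixes q :: "nat \<Rightarrow> nat \<Rightarrow> 'a :: comm_ring_1"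
  assumes "\<And>i. i < n \<Longrightarrow> q (Suc i) 0 = 0"
  shows "det (mat (Suc n) (Suc n) (\<lambda>(i, j). q i j)) =
    q 0 0 * det (mat n n (\<lambda>(i, j). q (Suc i) (Suc j)))"
proof -
  let ?A = "mat (Suc n) (Suc n) (\<lambda>(i, j). q i j)"
  have "det ?A = (\<Sum>i<Suc n. ?A $$ (i, 0) * cofactor ?A i 0)"
    by (rule laplace_expansion_column) auto
  also have "\<dots> = q 0 0 * cofactor ?A 0 0"
    using assms by (simp add: sum.lessThan_Suc_shift del: sum.lessThan_Suc)
  also have "mat_delete ?A 0 0 = mat n n (\<lambda>(i, j). q (Suc i) (Suc j))"
    by (rule eq_matI) (auto simp: mat_delete_def)
  then have "cofactor ?A 0 0 = det (mat n n (\<lambda>(i, j). q (Suc i) (Suc j)))"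
    by (simp add: cofactor_def)
  finally show ?thesis .
qed

lemma vandermonde_det_nonzero:
  fixes x :: "nat \<Rightarrow> 'a :: idom"
  assumes "inj_on x {..<n}"
  shows "det (mat n n (\<lambda>(i, j). x j ^ i)) \<noteq> 0"
proof
  let ?V = "mat n n (\<lambda>(i, j). x j ^ i)"
  assume "det ?V = 0"
  then have "det (transpose_mat ?V) = 0"
    by (subst det_transpose[of _ n]) auto
  then obtain v where v: "v \<in> carrier_vec n" "v \<noteq> 0\<^sub>v n" "transpose_mat ?V *\<^sub>v v = 0\<^sub>v n"
    using det_0_iff_vec_prod_zero[of "transpose_mat ?V" n] by auto
  then have "n > 0"
    by (cases n) auto
  define p where "p = (\<Sum>i<n. monom (vec_index v i) i)"
  have coeff_p: "coeff p i = (if i < n then vec_index v i else 0)" for i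
    by (simp add: p_def coeff_sum)
  have root: "poly p (x j) = 0" if "j < n" for j
  proof -
    have "poly p (x j) = vec_index (transpose_mat ?V *\<^sub>v v) j"
      using that v(1)
      by (simp add: p_def poly_sum poly_monom scalar_prod_def atLeast0LessThan mult.commute)
    then show ?thesis
      using that v(3) by simp
  qed
  have "degree p < n"
    using \<open>n > 0\<close> by (intro degree_lessI) (auto simp: coeff_p)
  then have "p = 0"
    using root \<open>n > 0\<close> by (intro poly_eqI_degree[of "x ` {..<n}"]) (auto simp: card_image assms)
  then have "vec_index v i = 0" if "i < n" for i
    using coeff_p[of i] that by simp
  then have "v = 0\<^sub>v n"
    using v(1) by (intro eq_vecI) auto
  with v(2) show False ..
qed

lemma coeff_mult_degree_le:
  fixes p q :: "'a :: comm_semiring_0 poly"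
  assumes "degree p \<le> m" "degree q \<le> n"
  shows "coeff (p * q) (m + n) = coeff p m * coeff q n"
proof -
  have "coeff (p * q) (m + n) = (\<Sum>i\<le>m + n. coeff p i * coeff q (m + n - i))"
    by (rule coeff_mult)
  also have "\<dots> = (\<Sum>i\<in>{m}. coeff p i * coeff q (m + n - i))"
  proof (rule sum.mono_neutral_right, simp_all, rule ballI)
    fix i assume "i \<in> {..m + n} - {m}"
    then consider "i > degree p" | "m + n - i > degree q"
      using assms by force
    then show "coeff p i * coeff q (m + n - i) = 0"
      by cases (simp_all add: coeff_eq_0)
  qed
  finally show ?thesis
    by simp
qed

lemma coeff_prod_degree_le:
  fixes f :: "'b \<Rightarrow> 'a :: comm_semiring_1 poly"
  assumes "finite S" "\<And>i. i \<in> S \<Longrightarrow> degree (f i) \<le> k"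
  shows "coeff (\<Prod>i\<in>S. f i) (k * card S) = (\<Prod>i\<in>S. coeff (f i) k)"
  using assms
proof (induction S rule: finite_induct)
  case (insert a S)
  have "degree (\<Prod>i\<in>S. f i) \<le> (\<Sum>i\<in>S. degree (f i))"
    using degree_prod_sum_le[OF insert.hyps(1), of f] by (simp add: o_def)
  also have "\<dots> \<le> k * card S"
    using sum_bounded_above[of S "\<lambda>i. degree (f i)" k] insert.prems by (simp add: mult.commute)
  finally show ?case
    using insert coeff_mult_degree_le[of "f a" k "\<Prod>i\<in>S. f i" "k * card S"] by simp
qed simp

lemma coeff_det_degree_le:
  fixes A :: "'a :: comm_ring_1 poly mat"
  assumes "A \<in> carrier_mat n n" "\<And>i j. i < n \<Longrightarrow> j < n \<Longrightarrow> degree (A $$ (i, j)) \<le> k"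
  shows "coeff (det A) (k * n) = det (map_mat (\<lambda>q. coeff q k) A)"
proof -
  have "coeff (signof p * (\<Prod>i = 0..<n. A $$ (i, p i))) (k * n) =
      signof p * (\<Prod>i = 0..<n. map_mat (\<lambda>q. coeff q k) A $$ (i, p i))"
    if "p permutes {0..<n}" for p
  proof -
    have perm: "p i < n" if "i < n" for i
      using permutes_in_image[OF \<open>p permutes {0..<n}\<close>, of i] that by simp
    then have "coeff (\<Prod>i = 0..<n. A $$ (i, p i)) (k * n) = (\<Prod>i = 0..<n. coeff (A $$ (i, p i)) k)"
      using coeff_prod_degree_le[of "{0..<n}" "\<lambda>i. A $$ (i, p i)" k] assms(2) by simp
    then show ?thesis
      using assms(1) perm by (simp add: sign_def)
  qed
  then show ?thesis
    using assms(1) by (simp add: det_def'[of _ n] coeff_sum)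
qed

subsection \<open>Wronskians and Darboux transformations in differential algebra\<close>

locale derivation =
  fixes d :: "'a :: comm_ring_1 \<Rightarrow> 'a"
  assumes d_add: "d (x + y) = d x + d y"
    and d_mult: "d (x * y) = d x * y + x * d y"
begin

lemma d_0 [simp]: "d 0 = 0"
  using d_add[of 0 0] by simp

lemma d_1 [simp]: "d 1 = 0"
  using d_mult[of 1 1] by simp

lemma d_minus: "d (- x) = - d x"
  using d_add[of x "- x"] by (simp add: eq_neg_iff_add_eq_0 add.commute)

lemma d_diff: "d (x - y) = d x - d y"
  using d_add[of x "- y"] by (simp add: d_minus)

lemma d_sum: "d (\<Sum>i\<in>A. f i) = (\<Sum>i\<in>A. d (f i))"
  by (induction A rule: infinite_finite_induct) (simp_all add: d_add)

lemma d_of_nat [simp]: "d (of_nat n) = 0"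
  by (induction n) (simp_all add: d_add)

lemmas d_simps = d_add d_diff d_mult

lemma d_power_exp:
  assumes "d e = e"
  shows "d (e ^ n) = of_nat n * e ^ n"
  by (induction n) (simp_all add: d_mult assms algebra_simps)

lemma funpow_d_0 [simp]: "(d ^^ n) 0 = 0"
  by (induction n) simp_all

lemma funpow_d_diff: "(d ^^ n) (x - y) = (d ^^ n) x - (d ^^ n) y"
  by (induction n) (simp_all add: d_diff)

lemma leibniz_rule:
  "(d ^^ n) (x * y) = (\<Sum>k\<le>n. of_nat (n choose k) * (d ^^ k) x * (d ^^ (n - k)) y)"
proof (induction n)
  case (Suc n)
  let ?t = "\<lambda>k. (d ^^ k) x * (d ^^ (Suc n - k)) y"
  have "(d ^^ Suc n) (x * y) =
      (\<Sum>k\<le>n. of_nat (n choose k) * ?t (Suc k)) + (\<Sum>k\<le>n. of_nat (n choose k) * ?t k)"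
    by (simp add: Suc d_sum d_mult sum.distrib Suc_diff_le algebra_simps)
  also have "(\<Sum>k\<le>n. of_nat (n choose k) * ?t k) = (\<Sum>k\<le>Suc n. of_nat (n choose k) * ?t k)"
    by (simp add: binomial_eq_0)
  also have "\<dots> = ?t 0 + (\<Sum>k\<le>n. of_nat (n choose Suc k) * ?t (Suc k))"
    by (subst sum.atMost_Suc_shift) simp
  also have "(\<Sum>k\<le>n. of_nat (n choose k) * ?t (Suc k)) + \<dots> =
      ?t 0 + (\<Sum>k\<le>n. of_nat (Suc n choose Suc k) * ?t (Suc k))"
    by (simp add: sum.distrib algebra_simps)
  also have "\<dots> = (\<Sum>k\<le>Suc n. of_nat (Suc n choose k) * ?t k)"
    by (subst sum.atMost_Suc_shift) simp
  finally show ?case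
    by (simp only: mult.assoc)
qed simp

definition formal_wronskian :: "nat \<Rightarrow> (nat \<Rightarrow> 'a) \<Rightarrow> 'a" where
  "formal_wronskian n f = det (mat n n (\<lambda>(i, j). (d ^^ i) (f j)))"

lemma formal_wronskian_reduce:
  assumes "d (f 0) = g * f 0"
  shows "formal_wronskian (Suc n) f =
    f 0 * formal_wronskian n (\<lambda>j. d (f (Suc j)) - g * f (Suc j))"
proof -
  define t where "t i k = - of_nat ((i - 1) choose k) * (d ^^ (i - 1 - k)) g" for i k
  have row: "(d ^^ Suc i) y + (\<Sum>k<Suc i. t (Suc i) k * (d ^^ k) y) = (d ^^ i) (d y - g * y)" for i y
    using leibniz_rule[of i y g]
    by (simp add: t_def funpow_d_diff lessThan_Suc_atMost sum_negf mult_ac funpow_Suc_right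
        del: funpow.simps sum.lessThan_Suc sum.atMost_Suc)
  have "formal_wronskian (Suc n) f =
      det (mat (Suc n) (Suc n) (\<lambda>(i, j). (d ^^ i) (f j) + (\<Sum>k<i. t i k * (d ^^ k) (f j))))"
    by (simp only: formal_wronskian_def det_add_previous_rows)
  also have "\<dots> = f 0 * formal_wronskian n (\<lambda>j. d (f (Suc j)) - g * f (Suc j))"
    unfolding formal_wronskian_def
    by (subst det_first_column_zero) (simp_all only: row, simp_all add: assms)
  finally show ?thesis .
qed

definition hirota :: "nat \<Rightarrow> 'a \<Rightarrow> 'a \<Rightarrow> 'a" where
  "hirota n p q = d (d q) * p - 2 * d q * d p + q * d (d p)
    + of_nat n * d q * p - of_nat (n + 1) * q * d p"

lemma hirota_scale:
  assumes "d a = 0" "d b = 0"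
  shows "hirota n (a * p) (b * q) = a * b * hirota n p q"
  by (simp add: hirota_def d_mult assms algebra_simps)

text \<open>The operator identity \<open>(d - 1 - g) (d - a + g) (d - g) = (d - 1 - g) (d\<^sup>2 - a d + v)\<close>.\<close>

lemma darboux_intertwining:
  assumes "d a = 0" and v: "v = a * g - d g - g\<^sup>2" and z: "z = d y - g * y"
  shows "d (d z) - (a + 1) * d z + (v + 2 * d g - g + a) * z =
    d (d (d y) - a * d y + v * y) - (1 + g) * (d (d y) - a * d y + v * y)"
  unfolding v z by (simp add: assms(1) d_simps power2_eq_square algebra_simps)

end

locale differential_field = derivation d for d :: "'a :: field \<Rightarrow> 'a"
begin

definition log_deriv :: "'a \<Rightarrow> 'a" where
  "log_deriv x = d x / x"

lemma d_eq_log_deriv_mult: "x \<noteq> 0 \<Longrightarrow> d x = log_deriv x * x"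
  by (simp add: log_deriv_def)

lemma log_deriv_mult: "x \<noteq> 0 \<Longrightarrow> y \<noteq> 0 \<Longrightarrow> log_deriv (x * y) = log_deriv x + log_deriv y"
  by (simp add: log_deriv_def d_mult field_simps)

lemma riccati_log_deriv:
  assumes "y \<noteq> 0" and ode: "d (d y) - a * d y + v * y = 0"
  shows "v = a * log_deriv y - d (log_deriv y) - (log_deriv y)\<^sup>2"
proof -
  have "(v - (a * log_deriv y - d (log_deriv y) - (log_deriv y)\<^sup>2)) * y = d (d y) - a * d y + v * y"
    by (simp add: d_eq_log_deriv_mult[OF assms(1)] d_mult algebra_simps power2_eq_square)
  with assms show ?thesis
    by simp
qed

lemma hirota_eq_log_deriv:
  assumes "p \<noteq> 0" "q \<noteq> 0"
  shows "hirota n p q = (d (log_deriv q) + d (log_deriv p) + (log_deriv q - log_deriv p)\<^sup>2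
    + of_nat n * log_deriv q - of_nat (n + 1) * log_deriv p) * (p * q)"
  by (simp add: hirota_def d_eq_log_deriv_mult[OF assms(1)] d_eq_log_deriv_mult[OF assms(2)]
      d_mult power2_eq_square algebra_simps)

text \<open>\<open>crum_transform f n j\<close> is \<open>L\<^sub>n (f j)\<close>, where \<open>L\<^sub>n\<close> is the monic operator of order \<open>n\<close> that
  annihilates \<open>f 0, \<dots>, f (n - 1)\<close>. When \<open>crum_transform f n n = 0\<close> the junk value of the logarithmic
  derivative is harmless: the step is then plain differentiation, which still annihilates it.\<close>

fun crum_transform :: "(nat \<Rightarrow> 'a) \<Rightarrow> nat \<Rightarrow> nat \<Rightarrow> 'a" where
  "crum_transform f 0 j = f j"
| "crum_transform f (Suc n) j =
    d (crum_transform f n j) - log_deriv (crum_transform f n n) * crum_transform f n j"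

declare crum_transform.simps(2) [simp del]

lemma d_crum_transform_diag:
  "d (crum_transform f n n) = log_deriv (crum_transform f n n) * crum_transform f n n"
  by (cases "crum_transform f n n = 0") (simp_all add: d_eq_log_deriv_mult)

lemma crum_transform_eq_0: "j < n \<Longrightarrow> crum_transform f n j = 0"
proof (induction n)
  case (Suc n)
  then show ?case
    by (cases "j = n") (simp_all add: crum_transform.simps(2) d_crum_transform_diag)
qed simp

lemma formal_wronskian_crum_transform:
  "formal_wronskian n (\<lambda>j. crum_transform f m (m + j)) =
    (\<Prod>k<n. crum_transform f (m + k) (m + k))"
proof (induction n arbitrary: m)
  case 0
  then show ?case
    by (simp add: formal_wronskian_def)
next
  case (Suc n)
  have "formal_wronskian (Suc n) (\<lambda>j. crum_transform f m (m + j)) =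
      crum_transform f m m * formal_wronskian n (\<lambda>j. crum_transform f (Suc m) (Suc m + j))"
    by (subst formal_wronskian_reduce[where g = "log_deriv (crum_transform f m m)"])
       (simp_all add: d_crum_transform_diag crum_transform.simps(2))
  also have "\<dots> = (\<Prod>k<Suc n. crum_transform f (m + k) (m + k))"
    unfolding Suc.IH by (simp add: prod.lessThan_Suc_shift del: prod.lessThan_Suc)
  finally show ?case .
qed

lemma formal_wronskian_Suc:
  "formal_wronskian (Suc n) f = formal_wronskian n f * crum_transform f n n"
  using formal_wronskian_crum_transform[of _ f 0] by simp

end

text \<open>For \<open>j = 0\<close> the truncated index in \<open>f (j - 1)\<close> is harmless because \<open>c 0 = 0\<close>.\<close>

locale darboux_tower = differential_field d for d :: "'a :: field \<Rightarrow> 'a" +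
  fixes e :: 'a and c f p :: "nat \<Rightarrow> 'a"
  assumes e_nonzero: "e \<noteq> 0"
    and d_e: "d e = e"
    and c_0: "c 0 = 0"
    and d_c: "d (c j) = 0"
    and d_d_f: "d (d (f j)) = c j * e * f (j - 1)"
    and p_nonzero: "p n \<noteq> 0"
    and formal_wronskian_f: "formal_wronskian n f = p n * e ^ (\<Sum>j<n. j)"
begin

abbreviation wronskian_ratio :: "nat \<Rightarrow> 'a" where
  "wronskian_ratio n \<equiv> crum_transform f n n"

definition potential :: "nat \<Rightarrow> 'a" where
  "potential n = 2 * d (log_deriv (p n)) - log_deriv (p n)"

text \<open>The operator \<open>e\<^sup>x h\<^sub>n\<close>, with \<open>p n\<close> in the role of \<open>P\<^sub>n\<close>.\<close>

definition darboux_op :: "nat \<Rightarrow> 'a \<Rightarrow> 'a" where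
  "darboux_op n y = d (d y) - of_nat n * d y + potential n * y"

lemma p_0: "p 0 = 1"
  using formal_wronskian_f[of 0] by (simp add: formal_wronskian_def)

lemma p_Suc: "p (Suc n) * e ^ n = p n * wronskian_ratio n"
proof -
  have "(p (Suc n) * e ^ n) * e ^ (\<Sum>j<n. j) = (p n * wronskian_ratio n) * e ^ (\<Sum>j<n. j)"
    using formal_wronskian_Suc[of n f] by (simp add: formal_wronskian_f power_add mult_ac)
  then show ?thesis
    using e_nonzero by simp
qed

lemma wronskian_ratio_nonzero: "wronskian_ratio n \<noteq> 0"
  using p_Suc[of n] p_nonzero[of "Suc n"] e_nonzero by auto

lemma log_deriv_p_Suc:
  "log_deriv (p (Suc n)) = log_deriv (p n) + log_deriv (wronskian_ratio n) - of_nat n"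
proof -
  have "log_deriv (p (Suc n)) + log_deriv (e ^ n) = log_deriv (p n) + log_deriv (wronskian_ratio n)"
    using p_Suc[of n] p_nonzero e_nonzero wronskian_ratio_nonzero by (simp flip: log_deriv_mult)
  moreover have "log_deriv (e ^ n) = of_nat n"
    using e_nonzero by (simp add: log_deriv_def d_power_exp[OF d_e])
  ultimately show ?thesis
    by (simp add: algebra_simps)
qed

lemma potential_Suc:
  "potential (Suc n) =
    potential n + 2 * d (log_deriv (wronskian_ratio n)) - log_deriv (wronskian_ratio n) + of_nat n"
  by (simp add: potential_def log_deriv_p_Suc d_simps algebra_simps)

lemma c_mult_crum_transform_pred: "c n * crum_transform f n (n - 1) = 0"
  by (cases n) (simp_all add: c_0 crum_transform_eq_0)

lemma potential_eq_riccati: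
  assumes "darboux_op n (wronskian_ratio n) = c n * e * crum_transform f n (n - 1)"
  shows "potential n = of_nat n * log_deriv (wronskian_ratio n)
    - d (log_deriv (wronskian_ratio n)) - (log_deriv (wronskian_ratio n))\<^sup>2"
proof (rule riccati_log_deriv[OF wronskian_ratio_nonzero])
  have "darboux_op n (wronskian_ratio n) = 0"
    using assms c_mult_crum_transform_pred[of n] by (simp add: mult_ac)
  then show "d (d (wronskian_ratio n)) - of_nat n * d (wronskian_ratio n)
      + potential n * wronskian_ratio n = 0"
    by (simp only: darboux_op_def)
qed

lemma darboux_op_crum_transform:
  "darboux_op n (crum_transform f n j) = c j * e * crum_transform f n (j - 1)"
proof (induction n arbitrary: j)
  case 0
  then show ?case
    by (simp add: darboux_op_def potential_def log_deriv_def p_0 d_d_f)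
next
  case (Suc n)
  let ?g = "log_deriv (wronskian_ratio n)"
  have "darboux_op (Suc n) (crum_transform f (Suc n) j) =
      d (darboux_op n (crum_transform f n j)) - (1 + ?g) * darboux_op n (crum_transform f n j)"
    using darboux_intertwining[OF d_of_nat potential_eq_riccati crum_transform.simps(2)] Suc.IH
    by (simp add: darboux_op_def potential_Suc add.commute[of 1])
  also have "\<dots> = c j * e * crum_transform f (Suc n) (j - 1)"
    by (simp add: Suc.IH crum_transform.simps(2) d_mult d_c d_e algebra_simps)
  finally show ?case .
qed

lemma hirota_p: "hirota n (p n) (p (Suc n)) = 0"
proof -
  have "log_deriv (wronskian_ratio n) = log_deriv (p (Suc n)) - log_deriv (p n) + of_nat n"
    by (simp add: log_deriv_p_Suc)
  with potential_eq_riccati[OF darboux_op_crum_transform, of n]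
  have "d (log_deriv (p (Suc n))) + d (log_deriv (p n))
      + (log_deriv (p (Suc n)) - log_deriv (p n))\<^sup>2
      + of_nat n * log_deriv (p (Suc n)) - of_nat (n + 1) * log_deriv (p n) = 0"
    by (simp only: potential_def) (simp add: d_simps power2_eq_square algebra_simps)
  then show ?thesis
    by (simp only: hirota_eq_log_deriv[OF p_nonzero p_nonzero] mult_zero_left)
qed

end

subsection \<open>Exponential polynomials\<close>

definition exp_conj_pderiv :: "'a :: idom \<Rightarrow> 'a poly \<Rightarrow> 'a poly" where
  "exp_conj_pderiv a p = pderiv p + smult a p"

lemma degree_exp_conj_pderiv_le: "degree (exp_conj_pderiv a p) \<le> degree p"
  by (rule degree_le) (simp add: exp_conj_pderiv_def coeff_pderiv coeff_eq_0)

lemma coeff_exp_conj_pderiv: "degree p \<le> n \<Longrightarrow> coeff (exp_conj_pderiv a p) n = a * coeff p n"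
  by (simp add: exp_conj_pderiv_def coeff_pderiv coeff_eq_0)

lemma degree_funpow_exp_conj_pderiv_le: "degree ((exp_conj_pderiv a ^^ i) p) \<le> degree p"
  by (induction i) (auto intro: order.trans[OF degree_exp_conj_pderiv_le])

lemma coeff_funpow_exp_conj_pderiv:
  "degree p \<le> n \<Longrightarrow> coeff ((exp_conj_pderiv a ^^ i) p) n = a ^ i * coeff p n"
  by (induction i) (simp_all add: coeff_exp_conj_pderiv
      order.trans[OF degree_funpow_exp_conj_pderiv_le])

lemma deriv_funpow_poly_exp:
  "(deriv ^^ i) (\<lambda>x :: real. poly p x * exp (a * x)) =
    (\<lambda>x. poly ((exp_conj_pderiv a ^^ i) p) x * exp (a * x))"
proof (induction i)
  case (Suc i)
  have "deriv (\<lambda>x. poly q x * exp (a * x)) x = poly (exp_conj_pderiv a q) x * exp (a * x)" for q x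
    by (rule DERIV_imp_deriv)
       (auto intro!: derivative_eq_intros simp: exp_conj_pderiv_def algebra_simps)
  with Suc show ?case
    by auto
qed simp

definition fls_of_poly :: "'a :: idom poly \<Rightarrow> 'a fls" where
  "fls_of_poly p = fps_to_fls (fps_of_poly p)"

interpretation fls_of_poly: inj_comm_ring_hom fls_of_poly
  by unfold_locales
     (auto simp: fls_of_poly_def fps_of_poly_add fps_of_poly_mult fls_times_fps_to_fls
        simp flip: fps_of_poly_0)

interpretation pderiv: derivation "pderiv :: 'a :: idom poly \<Rightarrow> 'a poly"
  by unfold_locales (simp_all add: pderiv_add pderiv_mult algebra_simps)

interpretation fls: differential_field "fls_deriv :: 'a :: field fls \<Rightarrow> 'a fls"
  by unfold_locales (simp_all add: algebra_simps)

lemma fls_of_poly_smult: "fls_of_poly (smult a p) = fls_const a * fls_of_poly p"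
  by (simp add: fls_of_poly_def fps_of_poly_smult fls_times_fps_to_fls)

lemma fls_deriv_of_poly: "fls_deriv (fls_of_poly p) = fls_of_poly (pderiv p)"
  by (simp add: fls_of_poly_def fls_deriv_fps_to_fls fps_of_poly_pderiv)

lemma hirota_smult:
  "pderiv.hirota n (smult a p) (smult b q) = smult (a * b) (pderiv.hirota n p q)"
  using pderiv.hirota_scale[of "[:a:]" "[:b:]" n p q] by (simp add: mult.commute)

lemma hirota_fls_of_poly:
  "fls.hirota n (fls_of_poly p) (fls_of_poly q) = fls_of_poly (pderiv.hirota n p q)"
  by (simp add: fls.hirota_def pderiv.hirota_def fls_deriv_of_poly hom_distribs)

definition fls_exp :: "'a :: field_char_0 fls" where
  "fls_exp = fps_to_fls (fps_exp 1)"

lemma fls_exp_nonzero: "fls_exp \<noteq> 0"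
  by (simp add: fls_exp_def)

lemma fls_deriv_exp: "fls_deriv fls_exp = fls_exp"
  by (simp add: fls_exp_def fls_deriv_fps_to_fls)

lemma fls_deriv_funpow_poly_exp:
  "(fls_deriv ^^ i) (fls_of_poly p * fls_exp ^ j) =
    fls_of_poly ((exp_conj_pderiv (of_nat j) ^^ i) p) * fls_exp ^ j"
proof (induction i)
  case (Suc i)
  have "fls_deriv (fls_of_poly q * fls_exp ^ j) =
      fls_of_poly (exp_conj_pderiv (of_nat j) q) * fls_exp ^ j"
    for q :: "'a poly"
    by (simp add: fls_deriv_of_poly fls.d_power_exp[OF fls_deriv_exp] exp_conj_pderiv_def fls_of_nat
        fls_of_poly_smult fls_of_poly.hom_add algebra_simps)
  with Suc show ?case
    by simp
qed simp

subsection \<open>The Wronskian of the functions \<open>\<omega>\<^sub>j\<close>\<close>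

definition omega_deriv_poly :: "nat \<Rightarrow> nat \<Rightarrow> real poly" where
  "omega_deriv_poly i j = (exp_conj_pderiv (real j) ^^ i) [:- a_coef (Suc j), 1:]"

definition omega_wronskian_poly :: "nat \<Rightarrow> real poly" where
  "omega_wronskian_poly n = det (mat n n (\<lambda>(i, j). omega_deriv_poly i j))"

lemma degree_omega_deriv_poly_le: "degree (omega_deriv_poly i j) \<le> 1"
  using degree_funpow_exp_conj_pderiv_le[of i "real j" "[:- a_coef (Suc j), 1:]"]
  by (simp add: omega_deriv_poly_def)

lemma coeff_omega_wronskian_poly_nonzero: "coeff (omega_wronskian_poly n) n \<noteq> 0"
proof -
  have "coeff (omega_wronskian_poly n) (1 * n) =
      det (map_mat (\<lambda>q. coeff q 1) (mat n n (\<lambda>(i, j). omega_deriv_poly i j)))"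
    unfolding omega_wronskian_poly_def
    by (rule coeff_det_degree_le) (simp_all add: degree_omega_deriv_poly_le del: One_nat_def)
  also have "map_mat (\<lambda>q. coeff q 1) (mat n n (\<lambda>(i, j). omega_deriv_poly i j)) =
      mat n n (\<lambda>(i, j). real j ^ i)"
    by (rule eq_matI) (simp_all add: omega_deriv_poly_def coeff_funpow_exp_conj_pderiv)
  also have "det \<dots> \<noteq> 0"
    by (rule vandermonde_det_nonzero) (simp add: inj_on_def)
  finally show ?thesis
    by simp
qed

lemma omega_wronskian_poly_nonzero: "omega_wronskian_poly n \<noteq> 0"
  using coeff_omega_wronskian_poly_nonzero[of n] by auto

lemma degree_omega_wronskian_poly: "degree (omega_wronskian_poly n) = n"
proof (rule antisym)
  have "degree (omega_wronskian_poly n) \<le> 1 * n"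
    unfolding omega_wronskian_poly_def
    by (rule degree_det_le) (simp_all add: degree_omega_deriv_poly_le del: One_nat_def)
  then show "degree (omega_wronskian_poly n) \<le> n"
    by simp
qed (rule le_degree[OF coeff_omega_wronskian_poly_nonzero])

lemma omega_wronskian_poly_1: "omega_wronskian_poly 1 = [:0, 1:]"
  by (simp add: omega_wronskian_poly_def det_single omega_deriv_poly_def)

lemma omega_wronskian_poly_2: "omega_wronskian_poly 2 = [:2, -2, 1:]"
proof -
  have "omega_wronskian_poly 2 =
      omega_deriv_poly 0 0 * omega_deriv_poly 1 1 - omega_deriv_poly 0 1 * omega_deriv_poly 1 0"
    unfolding omega_wronskian_poly_def
    by (subst laplace_expansion_column[of _ 2 0])
       (auto simp: numeral_2_eq_2 cofactor_def det_single mat_delete_def)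
  then show ?thesis
    by (simp add: omega_deriv_poly_def exp_conj_pderiv_def pderiv_pCons numeral_2_eq_2)
qed

lemma wronskian_omega:
  "wronskian n omega x = poly (omega_wronskian_poly n) x * exp (real n * (real n - 1) * x / 2)"
proof -
  interpret eval: comm_ring_hom "\<lambda>p. poly p x"
    by unfold_locales auto
  have "omega (Suc j) = (\<lambda>x. poly [:- a_coef (Suc j), 1:] x * exp (real j * x))" for j
    by (simp add: omega_def fun_eq_iff)
  then have "wronskian n omega x =
      det (mat n n (\<lambda>(i, j). poly (omega_deriv_poly i j) x * exp (real j * x)))"
    by (simp only: wronskian_def omega_deriv_poly_def Suc_eq_plus1[symmetric] deriv_funpow_poly_exp)
  also have "\<dots> = poly (omega_wronskian_poly n) x * (\<Prod>j<n. exp (real j * x))"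
    by (simp only: eval.det_hom_scale_columns omega_wronskian_poly_def)
  also have "(\<Prod>j<n. exp (real j * x)) = exp (real n * (real n - 1) * x / 2)"
    by (induction n) (simp_all add: field_simps flip: exp_add)
  finally show ?thesis .
qed

definition fls_omega :: "nat \<Rightarrow> real fls" where
  "fls_omega j = fls_of_poly [:- a_coef (Suc j), 1:] * fls_exp ^ j"

lemma fls_deriv_funpow_omega:
  "(fls_deriv ^^ i) (fls_omega j) = fls_of_poly (omega_deriv_poly i j) * fls_exp ^ j"
  by (simp only: fls_omega_def omega_deriv_poly_def fls_deriv_funpow_poly_exp)

lemma formal_wronskian_fls_omega:
  "fls.formal_wronskian n fls_omega = fls_of_poly (omega_wronskian_poly n) * fls_exp ^ (\<Sum>j<n. j)"
  by (simp only: fls.formal_wronskian_def fls_deriv_funpow_omega fls_of_poly.det_hom_scale_columns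
      omega_wronskian_poly_def power_sum)

text \<open>Here the recursion for \<open>a\<^sub>j\<close> enters.\<close>

lemma omega_deriv_poly_2_Suc:
  "omega_deriv_poly 2 (Suc j) = smult ((real (Suc j))\<^sup>2) (omega_deriv_poly 0 j)"
  by (simp add: omega_deriv_poly_def exp_conj_pderiv_def pderiv_pCons numeral_2_eq_2
      power2_eq_square field_simps)

lemma fls_deriv2_omega:
  "fls_deriv (fls_deriv (fls_omega j)) = fls_const ((real j)\<^sup>2) * fls_exp * fls_omega (j - 1)"
proof (cases j)
  case 0
  then show ?thesis
    by (simp add: fls_omega_def fls_deriv_of_poly pderiv_pCons)
next
  case (Suc k)
  have "fls_deriv (fls_deriv (fls_omega j)) = fls_of_poly (omega_deriv_poly 2 j) * fls_exp ^ j"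
    using fls_deriv_funpow_omega[of 2 j] by (simp add: numeral_2_eq_2)
  also have "\<dots> = fls_const ((real j)\<^sup>2) * fls_exp * fls_omega k"
    using fls_deriv_funpow_omega[of 0 k]
    by (simp add: Suc omega_deriv_poly_2_Suc fls_of_poly_smult mult_ac)
  finally show ?thesis
    by (simp add: Suc)
qed

interpretation omega: darboux_tower fls_deriv fls_exp "\<lambda>j. fls_const ((real j)\<^sup>2)" fls_omega
  "\<lambda>n. fls_of_poly (omega_wronskian_poly n)"
  by unfold_locales (simp_all add: fls_exp_nonzero fls_deriv_exp fls_deriv2_omega
      omega_wronskian_poly_nonzero formal_wronskian_fls_omega)

lemma hirota_omega_wronskian_poly:
  "pderiv.hirota n (omega_wronskian_poly n) (omega_wronskian_poly (Suc n)) = 0"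
  using omega.hirota_p[of n] by (simp add: hirota_fls_of_poly)

lemma c_const_nonzero: "c_const n \<noteq> 0"
  by (simp add: c_const_def)

theorem theorem6p1:
  shows "\<exists>P :: nat \<Rightarrow> real poly.
    (\<forall>n\<ge>1. degree (P n) = n) \<and>
    P 1 = [:0, 1:] \<and>
    P 2 = [:2, -2, 1:] \<and>
    (\<forall>n\<ge>1.
       pderiv (pderiv (P (n + 1))) * P n
       - 2 * pderiv (P (n + 1)) * pderiv (P n)
       + P (n + 1) * pderiv (pderiv (P n))
       + of_nat n * pderiv (P (n + 1)) * P n
       - of_nat (n + 1) * P (n + 1) * pderiv (P n) = 0) \<and>
    (\<forall>n\<ge>1. \<forall>x::real.
       poly (P n) x = c_const n * exp (- (real n * (real n - 1) * x / 2)) * wronskian n omega x)"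
proof (intro exI conjI allI impI)
  define P where "P n = smult (c_const n) (omega_wronskian_poly n)" for n
  show "degree (P n) = n" for n
    by (simp add: P_def c_const_nonzero degree_omega_wronskian_poly)
  have "c_const 1 = 1" "c_const 2 = 1"
    by (simp_all add: c_const_def)
  then show "P 1 = [:0, 1:]" "P 2 = [:2, -2, 1:]"
    by (simp_all only: P_def omega_wronskian_poly_1 omega_wronskian_poly_2 smult_1_left)
  have hirota: "pderiv.hirota n (P n) (P (n + 1)) = 0" for n
    by (simp add: P_def hirota_smult hirota_omega_wronskian_poly)
  show "pderiv (pderiv (P (n + 1))) * P n - 2 * pderiv (P (n + 1)) * pderiv (P n)
      + P (n + 1) * pderiv (pderiv (P n)) + of_nat n * pderiv (P (n + 1)) * P n
      - of_nat (n + 1) * P (n + 1) * pderiv (P n) = 0" for n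
    using hirota[of n] by (simp only: pderiv.hirota_def)
  show "poly (P n) x = c_const n * exp (- (real n * (real n - 1) * x / 2)) * wronskian n omega x"
    for n x
    by (simp add: P_def wronskian_omega exp_minus)
qed

end
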